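(* For every odd integer $k\ge 3$, the set of claws formed by the edges $M=\{v_iu_i^1,v_iu_i^2,v_iu_i^3 : 1\le i\le k\}$ is a planarizing perfect pseudo-matching of the flower snark $J_k$.
   Context: A perfect pseudo-matching $M$ in a graph $G$ is a collection of vertex-disjoint subgraphs of $G$, each isomorphic to $K_2$ or $K_{1,3}$, whose vertex sets together cover $V(G)$. $G/M$ is the (multi)graph obtained by contracting each member of $M$ to a single vertex. $M$ is planarizing if $G/M$ is planar. For an odd integer $k\ge 3$, the flower snark $J_k$ has vertex set $\{v_1,\dots,v_k\}\cup\{u_i^1,u_i^2,u_i^3 : 1\le i\le k\}$. Its edges are those of the cycle $u_1^1u_2^1\cdots u_k^1u_1^1$ of length $k$, those of the cycle $u_1^2u_2^2\cdots u_k^2u_1^3u_2^3\cdots u_k^3u_1^2$ of length $2k$, and the edges $v_iu_i^1,v_iu_i^2,v_iu_i^3$ for $1\le i\le k$. *)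

theory Defs
  imports "HOL-Analysis.Analysis"
begin

section \<open>Simple graphs\<close>

record 'v graph =
  verts :: "'v set"
  edges :: "'v set set"

definition simple_graph :: "'v graph \<Rightarrow> bool" where
  "simple_graph G \<longleftrightarrow> finite (verts G) \<and> (\<forall>e\<in>edges G. e \<subseteq> verts G \<and> card e = 2)"

definition subgraph :: "'v graph \<Rightarrow> 'v graph \<Rightarrow> bool" where
  "subgraph H G \<longleftrightarrow> simple_graph H \<and> simple_graph G \<and> verts H \<subseteq> verts G \<and> edges H \<subseteq> edges G"

definition graph_iso :: "'v graph \<Rightarrow> 'w graph \<Rightarrow> bool" where
  "graph_iso G H \<longleftrightarrow> (\<exists>f. bij_betw f (verts G) (verts H) \<and>
     (\<forall>x\<in>verts G. \<forall>y\<in>verts G. {x, y} \<in> edges G \<longleftrightarrow> {f x, f y} \<in> edges H))"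

definition K2 :: "nat graph" where
  "K2 = \<lparr>verts = {0, 1}, edges = {{0, 1}}\<rparr>"

definition K13 :: "nat graph" where
  "K13 = \<lparr>verts = {0, 1, 2, 3}, edges = {{0, 1}, {0, 2}, {0, 3}}\<rparr>"

definition perfect_pseudo_matching :: "'v graph \<Rightarrow> 'v graph set \<Rightarrow> bool" where
  "perfect_pseudo_matching G M \<longleftrightarrow>
     (\<forall>H\<in>M. subgraph H G \<and> (graph_iso H K2 \<or> graph_iso H K13)) \<and>
     pairwise (\<lambda>H K. disjnt (verts H) (verts K)) M \<and>
     (\<Union>H\<in>M. verts H) = verts G"


section \<open>Multigraphs, planarity and contraction\<close>

text \<open>Parallel edges are different edges with the same set of ends; a loop has just one end.\<close>

record ('v, 'e) multigraph =
  mverts :: "'v set"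
  medges :: "'e set"
  mends :: "'e \<Rightarrow> 'v set"

text \<open>In a plane embedding, a \<open>simple_path\<close> may be closed, which is needed for loops; it is an arc
  as soon as the edge has two different ends.\<close>

definition plane_embedding ::
    "('v, 'e) multigraph \<Rightarrow> ('v \<Rightarrow> complex) \<Rightarrow> ('e \<Rightarrow> real \<Rightarrow> complex) \<Rightarrow> bool" where
  "plane_embedding G p \<gamma> \<longleftrightarrow>
     inj_on p (mverts G) \<and>
     (\<forall>e\<in>medges G. simple_path (\<gamma> e) \<and>
        {pathstart (\<gamma> e), pathfinish (\<gamma> e)} = p ` mends G e \<and>
        path_image (\<gamma> e) \<inter> p ` mverts G = p ` mends G e) \<and>
     (\<forall>e\<in>medges G. \<forall>f\<in>medges G. e \<noteq> f \<longrightarrow>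
        path_image (\<gamma> e) \<inter> path_image (\<gamma> f) \<subseteq> p ` (mends G e \<inter> mends G f))"

definition planar :: "('v, 'e) multigraph \<Rightarrow> bool" where
  "planar G \<longleftrightarrow> (\<exists>p \<gamma>. plane_embedding G p \<gamma>)"

text \<open>The vertices of the contraction of a collection \<open>M\<close> of vertex-disjoint connected subgraphs
  are the vertex sets of the members of \<open>M\<close>, together with \<open>{v}\<close> for every vertex \<open>v\<close> in no member.
  The edges are the edges of the graph in no member; they keep their identity, so that
  parallel edges and loops created by the contraction are retained.\<close>

definition contract_class :: "'v graph set \<Rightarrow> 'v \<Rightarrow> 'v set" where
  "contract_class M v = insert v (\<Union>H\<in>{H \<in> M. v \<in> verts H}. verts H)"

definition contract :: "'v graph \<Rightarrow> 'v graph set \<Rightarrow> ('v set, 'v set) multigraph" where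
  "contract G M =
     \<lparr>mverts = contract_class M ` verts G,
      medges = edges G - (\<Union>H\<in>M. edges H),
      mends = (\<lambda>e. contract_class M ` e)\<rparr>"

definition planarizing :: "'v graph \<Rightarrow> 'v graph set \<Rightarrow> bool" where
  "planarizing G M \<longleftrightarrow> planar (contract G M)"


section \<open>Flower snarks\<close>

text \<open>\<open>V i\<close> stands for $v_i$ and \<open>U j i\<close> for $u_i^j$.\<close>

datatype snark_vertex = V nat | U nat nat

definition cycle_edges :: "'v list \<Rightarrow> 'v set set" where
  "cycle_edges xs = {{xs ! i, xs ! (Suc i mod length xs)} | i. i < length xs}"

definition flower_snark :: "nat \<Rightarrow> snark_vertex graph" where
  "flower_snark k =
     \<lparr>verts = {V i | i. i \<in> {1..k}} \<union> {U j i | j i. j \<in> {1..3} \<and> i \<in> {1..k}},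
      edges = cycle_edges (map (U 1) [1..<Suc k])
        \<union> cycle_edges (map (U 2) [1..<Suc k] @ map (U 3) [1..<Suc k])
        \<union> {{V i, U j i} | j i. j \<in> {1..3} \<and> i \<in> {1..k}}\<rparr>"

definition claw :: "nat \<Rightarrow> snark_vertex graph" where
  "claw i = \<lparr>verts = {V i, U 1 i, U 2 i, U 3 i},
             edges = {{V i, U 1 i}, {V i, U 2 i}, {V i, U 3 i}}\<rparr>"

definition snark_claws :: "nat \<Rightarrow> snark_vertex graph set" where
  "snark_claws k = claw ` {1..k}"

end

theory Submission
  imports Defs
begin

text \<open>
  Contracting the claws turns \<open>J\<^sub>k\<close> into a cycle of length \<open>k\<close> with every edge tripled. Put its
  vertices at the points \<open>1, \<dots>, k\<close> of the real axis and draw every edge as an arch, the graph of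
  \<open>x \<mapsto> c (x - a) (b - x)\<close> over the interval \<open>[a, b]\<close> between its ends. An arch lies
  strictly below any arch with larger \<open>c\<close> over a larger interval, except at common ends; so it
  suffices to give the three edges from \<open>k\<close> back to \<open>1\<close> the largest coefficients.
\<close>

section \<open>Arch drawings\<close>

definition arch :: "real \<Rightarrow> real \<Rightarrow> real \<Rightarrow> real \<Rightarrow> complex" where
  "arch a b c t = (let x = a + t * (b - a) in Complex x (c * ((x - a) * (b - x))))"

lemma arch_0 [simp]: "arch a b c 0 = of_real a"
  and arch_1 [simp]: "arch a b c 1 = of_real b"
  by (simp_all add: arch_def complex_eq_iff)

lemma pathstart_arch [simp]: "pathstart (arch a b c) = of_real a"
  and pathfinish_arch [simp]: "pathfinish (arch a b c) = of_real b"
  by (simp_all add: pathstart_def pathfinish_def)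

lemma arc_arch:
  assumes "a < b"
  shows "arc (arch a b c)"
proof -
  have "arch a b c = (\<lambda>t. Complex (a + t * (b - a))
          (c * ((a + t * (b - a) - a) * (b - (a + t * (b - a))))))"
    by (simp add: arch_def Let_def fun_eq_iff)
  then have "path (arch a b c)"
    by (auto simp: path_def Complex_eq intro!: continuous_intros)
  moreover have "inj_on (arch a b c) {0..1}"
    using assms by (auto simp: inj_on_def arch_def Let_def)
  ultimately show ?thesis
    by (simp add: arc_def)
qed

text \<open>This removes the parameter: the abscissa bounds and the height equation are all that the
  comparisons of arches below use.\<close>

lemma path_image_archD:
  assumes "z \<in> path_image (arch a b c)" "a \<le> b"
  shows "a \<le> Re z" "Re z \<le> b" "Im z = c * ((Re z - a) * (b - Re z))"
proof -
  obtain t where t: "0 \<le> t" "t \<le> 1" "z = arch a b c t"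
    using assms by (auto simp: path_image_def)
  have "t * (b - a) \<le> 1 * (b - a)"
    using t assms by (intro mult_right_mono) auto
  then show "a \<le> Re z" "Re z \<le> b" "Im z = c * ((Re z - a) * (b - Re z))"
    using t assms by (auto simp: arch_def Let_def)
qed

text \<open>The height is a quadratic with roots \<open>a\<close> and \<open>b\<close>, so an arch
  meets the real axis only there. As all vertices will lie on that axis, no edge runs through a
  third vertex.\<close>

lemma real_in_path_image_arch:
  assumes "of_real x \<in> path_image (arch a b c)" "a \<le> b" "0 < c"
  shows "x = a \<or> x = b"
  using path_image_archD(3)[OF assms(1,2)] assms(3) by auto

lemma arch_Int_disjoint:
  assumes "z \<in> path_image (arch a b c)" "z \<in> path_image (arch a' b' c')"
    and "a \<le> b" "a' \<le> b'" "b \<le> a'"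
  shows "z = of_real b \<and> z = of_real a'"
  using path_image_archD[OF assms(1,3)] path_image_archD[OF assms(2,4)] assms(5)
  by (auto simp: complex_eq_iff)

text \<open>Write P and P' for the products (x - a)(b - x) and (x - a')(b' - x) at a common point.
  Enlarging the interval enlarges both nonnegative factors, so c' P' = c P \<le> c P'. Since c < c'
  and P' \<ge> 0, this forces P' = 0.\<close>

lemma arch_Int_nested:
  assumes z: "z \<in> path_image (arch a b c)" "z \<in> path_image (arch a' b' c')"
    and "a \<le> b" "a' \<le> b'" "a' \<le> a" "b \<le> b'" "0 < c" "c < c'"
  shows "z = of_real a \<and> a = a' \<or> z = of_real b \<and> b = b'"
proof -
  note h = path_image_archD[OF z(1) \<open>a \<le> b\<close>] and h' = path_image_archD[OF z(2) \<open>a' \<le> b'\<close>]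
  have "c' * ((Re z - a') * (b' - Re z)) = c * ((Re z - a) * (b - Re z))"
    using h h' by simp
  also have "\<dots> \<le> c * ((Re z - a') * (b' - Re z))"
    using assms h by (intro mult_left_mono mult_mono) auto
  finally have "(c' - c) * ((Re z - a') * (b' - Re z)) \<le> 0"
    by (simp add: algebra_simps)
  moreover have "0 \<le> (Re z - a') * (b' - Re z)"
    using h' by simp
  ultimately have "(Re z - a') * (b' - Re z) = 0"
    using mult_pos_pos[of "c' - c"] \<open>c < c'\<close> by (smt (verit))
  then have "Re z = a' \<or> Re z = b'"
    by auto
  \<comment> \<open>An end of the outer interval that lies in the inner interval is an end of
    both.\<close>
  then show ?thesis
    using h h' assms by (auto simp: complex_eq_iff)
qed

text \<open>This reduces planarity to inequalities between numbers: \<open>r\<close> places the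
  vertices on the real axis, and \<open>x e\<close>, \<open>y e\<close> are the left and right end
  of \<open>e\<close>. Parallel edges are allowed: they span equal intervals and are told apart by
  their coefficients.\<close>

lemma planar_if_nested_arches:
  fixes G :: "('v, 'e) multigraph" and r :: "'v \<Rightarrow> real" and x y :: "'e \<Rightarrow> 'v" and c :: "'e \<Rightarrow> real"
  assumes inj: "inj_on r (mverts G)"
    and ends: "\<And>e. e \<in> medges G \<Longrightarrow> x e \<in> mverts G \<and> y e \<in> mverts G \<and> mends G e = {x e, y e}"
    and less: "\<And>e. e \<in> medges G \<Longrightarrow> r (x e) < r (y e)"
    and pos: "\<And>e. e \<in> medges G \<Longrightarrow> 0 < c e"
    and nested: "\<And>e f. e \<in> medges G \<Longrightarrow> f \<in> medges G \<Longrightarrow> e \<noteq> f \<Longrightarrow>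
       r (y e) \<le> r (x f) \<or> r (y f) \<le> r (x e) \<or>
       r (x f) \<le> r (x e) \<and> r (y e) \<le> r (y f) \<and> c e < c f \<or>
       r (x e) \<le> r (x f) \<and> r (y f) \<le> r (y e) \<and> c f < c e"
  shows "planar G"
proof -
  define p where "p = (\<lambda>v. complex_of_real (r v))"
  define \<gamma> where "\<gamma> = (\<lambda>e. arch (r (x e)) (r (y e)) (c e))"
  have injp: "inj_on p (mverts G)"
    using inj by (auto simp: p_def inj_on_def)
  have at_ends: "p ` mends G e = {p (x e), p (y e)}" if "e \<in> medges G" for e
    using ends[OF that] by auto
  have start_finish: "pathstart (\<gamma> e) = p (x e)" "pathfinish (\<gamma> e) = p (y e)" for e
    by (simp_all add: \<gamma>_def p_def)
  have "path_image (\<gamma> e) \<inter> p ` mverts G = p ` mends G e" if e: "e \<in> medges G" for e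
  proof
    show "path_image (\<gamma> e) \<inter> p ` mverts G \<subseteq> p ` mends G e"
    proof
      fix z assume "z \<in> path_image (\<gamma> e) \<inter> p ` mverts G"
      then obtain v where "z = p v" "of_real (r v) \<in> path_image (arch (r (x e)) (r (y e)) (c e))"
        by (auto simp: p_def \<gamma>_def)
      with real_in_path_image_arch[OF this(2)] less[OF e] pos[OF e] show "z \<in> p ` mends G e"
        unfolding at_ends[OF e] by (auto simp: p_def)
    qed
    show "p ` mends G e \<subseteq> path_image (\<gamma> e) \<inter> p ` mverts G"
      using ends[OF e] start_finish[of e] pathstart_in_path_image[of "\<gamma> e"]
        pathfinish_in_path_image[of "\<gamma> e"] by auto
  qed
  moreover have "path_image (\<gamma> e) \<inter> path_image (\<gamma> f) \<subseteq> p ` (mends G e \<inter> mends G f)"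
    if e: "e \<in> medges G" and f: "f \<in> medges G" and "e \<noteq> f" for e f
  proof
    fix z assume "z \<in> path_image (\<gamma> e) \<inter> path_image (\<gamma> f)"
    then have z: "z \<in> path_image (arch (r (x e)) (r (y e)) (c e))"
      "z \<in> path_image (arch (r (x f)) (r (y f)) (c f))"
      by (auto simp: \<gamma>_def)
    \<comment> \<open>The four alternatives of \<open>nested\<close> are intervals side by side or
      nested, each in both orders of \<open>e\<close> and \<open>f\<close>.\<close>
    have "z \<in> {p (x e), p (y e)} \<inter> {p (x f), p (y f)}"
      using nested[OF e f \<open>e \<noteq> f\<close>] arch_Int_disjoint[OF z] arch_Int_disjoint[OF z(2,1)]
        arch_Int_nested[OF z] arch_Int_nested[OF z(2,1)] less[OF e] less[OF f] pos[OF e] pos[OF f]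
      unfolding p_def by (smt (verit) IntI insertCI)
    also have "\<dots> = p ` mends G e \<inter> p ` mends G f"
      by (simp only: at_ends[OF e] at_ends[OF f])
    \<comment> \<open>Injectivity of \<open>p\<close> turns a common position of ends into a common
      end.\<close>
    also have "\<dots> = p ` (mends G e \<inter> mends G f)"
      using ends[OF e] ends[OF f] by (intro inj_on_image_Int[OF injp, symmetric]) auto
    finally show "z \<in> p ` (mends G e \<inter> mends G f)" .
  qed
  moreover have "simple_path (\<gamma> e)" if "e \<in> medges G" for e
    using less[OF that] by (simp add: \<gamma>_def arc_arch arc_imp_simple_path)
  ultimately have "plane_embedding G p \<gamma>"
    unfolding plane_embedding_def using injp at_ends start_finish by auto
  then show ?thesis
    unfolding planar_def by blast
qed

section \<open>The claws of a flower snark\<close>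

text \<open>This indexes the edges of both cycles by column \<open>i\<close> and row
  \<open>j\<close>. After column \<open>k\<close>, row 1 closes up, whereas \<open>5 - j\<close>
  exchanges rows 2 and 3: this is the twist that makes them a single cycle of length 2k.\<close>

definition rim_edge :: "nat \<Rightarrow> nat \<Rightarrow> nat \<Rightarrow> snark_vertex set" where
  "rim_edge k i j =
     (if i < k then {U j i, U j (Suc i)} else {U j k, U (if j = 1 then 1 else 5 - j) 1})"

lemma cycle_edges_flower_snark:
  assumes "0 < k"
  shows "cycle_edges (map (U 1) [1..<Suc k]) \<subseteq> {rim_edge k i j | i j. i \<in> {1..k} \<and> j \<in> {1..3}}"
    and "cycle_edges (map (U 2) [1..<Suc k] @ map (U 3) [1..<Suc k])
           \<subseteq> {rim_edge k i j | i j. i \<in> {1..k} \<and> j \<in> {1..3}}"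
proof -
  let ?R = "{rim_edge k i j | i j. i \<in> {1..k} \<and> j \<in> {1..3}}"
  have rim: "rim_edge k (Suc n) j \<in> ?R" if "n < k" "j \<in> {1..3}" for n j
    using that by force
  show "cycle_edges (map (U 1) [1..<Suc k]) \<subseteq> ?R"
  proof
    fix e assume "e \<in> cycle_edges (map (U 1) [1..<Suc k])"
    then obtain n where n: "n < k"
      "e = {map (U 1) [1..<Suc k] ! n, map (U 1) [1..<Suc k] ! (Suc n mod k)}"
      unfolding cycle_edges_def by (auto simp del: upt_Suc)
    consider "Suc n < k" | "Suc n = k"
      using n by linarith
    then have "e = rim_edge k (Suc n) 1"
      using n assms by cases (auto simp: rim_edge_def simp del: upt_Suc)
    then show "e \<in> ?R"
      using rim[OF n(1), of 1] by simp
  qed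
  show "cycle_edges (map (U 2) [1..<Suc k] @ map (U 3) [1..<Suc k]) \<subseteq> ?R"
  proof
    define xs where "xs = map (U 2) [1..<Suc k] @ map (U 3) [1..<Suc k]"
    \<comment> \<open>List positions start at 0 and columns at 1, hence the
      \<open>Suc\<close>.\<close>
    have nth: "xs ! m = (if m < k then U 2 (Suc m) else U 3 (Suc (m - k)))" if "m < k + k" for m
      using that by (auto simp: xs_def nth_append simp del: upt_Suc)
    fix e assume "e \<in> cycle_edges (map (U 2) [1..<Suc k] @ map (U 3) [1..<Suc k])"
    then have "e \<in> cycle_edges xs"
      by (simp only: xs_def)
    moreover have "length xs = k + k"
      by (simp add: xs_def)
    ultimately obtain n where n: "n < k + k" "e = {xs ! n, xs ! (Suc n mod (k + k))}"
      unfolding cycle_edges_def by auto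
    show "e \<in> ?R"
    proof (cases "n < k")
      case True
      \<comment> \<open>If \<open>Suc n = k\<close>, the next position is the first one of row 3 = 5
        - 2.\<close>
      then have "e = rim_edge k (Suc n) 2"
        using n(2) assms by (cases "Suc n = k") (auto simp: nth rim_edge_def)
      then show ?thesis
        using rim[OF True, of 2] by simp
    next
      case False
      then have n': "n - k < k"
        using n by linarith
      \<comment> \<open>At the last position the index wraps around to 0, the first position of row
        2 = 5 - 3.\<close>
      have "e = rim_edge k (Suc (n - k)) 3"
      proof (cases "Suc n = k + k")
        case True
        then have "n - k = k - 1" "Suc n mod (k + k) = 0"
          by simp_all
        then show ?thesis
          using n False assms by (auto simp: nth rim_edge_def)
      next
        case neq: False
        then have "Suc n < k + k" "Suc n mod (k + k) = Suc n"
          using n by simp_all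
        then show ?thesis
          using n(2) False by (auto simp: nth rim_edge_def Suc_diff_le)
      qed
      then show ?thesis
        using rim[OF n', of 3] by simp
    qed
  qed
qed

lemma edges_flower_snark_cases:
  assumes "e \<in> edges (flower_snark k)" "0 < k"
  obtains (rim) i j where "i \<in> {1..k}" "j \<in> {1..3}" "e = rim_edge k i j"
  | (claw) i j where "i \<in> {1..k}" "j \<in> {1..3}" "e = {V i, U j i}"
proof -
  have "e \<in> {rim_edge k i j | i j. i \<in> {1..k} \<and> j \<in> {1..3}}
          \<union> {{V i, U j i} | j i. j \<in> {1..3} \<and> i \<in> {1..k}}"
    using assms cycle_edges_flower_snark[OF assms(2)]
    unfolding flower_snark_def by (auto simp del: upt_Suc)
  then show thesis
    using that by blast
qed

lemma nat_1_3_iff: "j \<in> {1..3} \<longleftrightarrow> j = 1 \<or> j = 2 \<or> j = (3::nat)"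
  by auto

lemma simple_graph_flower_snark:
  assumes "k \<ge> 3"
  shows "simple_graph (flower_snark k)"
  unfolding simple_graph_def
proof (intro conjI ballI)
  have "verts (flower_snark k) = V ` {1..k} \<union> case_prod U ` ({1..3} \<times> {1..k})"
    by (auto simp: flower_snark_def)
  then show "finite (verts (flower_snark k))"
    by simp
next
  fix e assume e: "e \<in> edges (flower_snark k)"
  have "0 < k"
    using assms by simp
  show "e \<subseteq> verts (flower_snark k)"
    using e \<open>0 < k\<close>
  proof (cases rule: edges_flower_snark_cases)
    case (rim i j)
    then show ?thesis
      using assms by (auto simp: rim_edge_def flower_snark_def)
  next
    case (claw i j)
    then show ?thesis
      by (auto simp: flower_snark_def)
  qed
  show "card e = 2"
    using e \<open>0 < k\<close>
  proof (cases rule: edges_flower_snark_cases)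
    case (rim i j)
    \<comment> \<open>The closing edge of row 1 has two different ends because columns
      \<open>k\<close> and 1 differ.\<close>
    then show ?thesis
      using assms by (auto simp: rim_edge_def)
  next
    case (claw i j)
    then show ?thesis
      by simp
  qed
qed

lemma subgraph_claw:
  assumes "i \<in> {1..k}" "k \<ge> 3"
  shows "subgraph (claw i) (flower_snark k)"
proof -
  have "simple_graph (claw i)"
    by (auto simp: simple_graph_def claw_def)
  moreover have "verts (claw i) \<subseteq> verts (flower_snark k)"
    using assms(1) by (auto simp: claw_def flower_snark_def)
  moreover have "{V i, U j i} \<in> edges (flower_snark k)" if "j \<in> {1..3}" for j
    using assms(1) that unfolding flower_snark_def by auto
  then have "edges (claw i) \<subseteq> edges (flower_snark k)"
    by (auto simp: claw_def)
  ultimately show ?thesis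
    using simple_graph_flower_snark[OF assms(2)] by (simp add: subgraph_def)
qed

lemma graph_iso_claw_K13: "graph_iso (claw i) K13"
  unfolding graph_iso_def
proof (intro exI conjI)
  \<comment> \<open>In \<open>K13\<close> the centre is 0 and the leaves are 1, 2, 3, so a leaf is
    sent to its row.\<close>
  let ?f = "\<lambda>v. case v of V _ \<Rightarrow> 0 | U j _ \<Rightarrow> j"
  show "bij_betw ?f (verts (claw i)) (verts K13)"
    by (auto simp: bij_betw_def inj_on_def claw_def K13_def)
  show "\<forall>x\<in>verts (claw i). \<forall>y\<in>verts (claw i). {x, y} \<in> edges (claw i) \<longleftrightarrow> {?f x, ?f y} \<in> edges K13"
    by (auto simp: claw_def K13_def doubleton_eq_iff)
qed

lemma Union_verts_claw: "(\<Union>i\<in>{1..k}. verts (claw i)) = verts (flower_snark k)"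
  by (auto simp: claw_def flower_snark_def nat_1_3_iff)

lemma perfect_pseudo_matching_snark_claws:
  assumes "k \<ge> 3"
  shows "perfect_pseudo_matching (flower_snark k) (snark_claws k)"
  unfolding perfect_pseudo_matching_def
proof (intro conjI)
  show "\<forall>H\<in>snark_claws k. subgraph H (flower_snark k) \<and> (graph_iso H K2 \<or> graph_iso H K13)"
    using subgraph_claw assms graph_iso_claw_K13 by (auto simp: snark_claws_def)
  show "pairwise (\<lambda>H K. disjnt (verts H) (verts K)) (snark_claws k)"
    by (auto simp: pairwise_def snark_claws_def claw_def disjnt_def)
  show "(\<Union>H\<in>snark_claws k. verts H) = verts (flower_snark k)"
    using Union_verts_claw by (simp add: snark_claws_def)
qed

section \<open>Drawing the contraction\<close>

text \<open>Claws of different columns are disjoint, so the union defining the class consists of one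
  claw.\<close>

lemma contract_class_snark_claws:
  assumes "i \<in> {1..k}" "v \<in> verts (claw i)"
  shows "contract_class (snark_claws k) v = verts (claw i)"
  using assms by (auto simp: contract_class_def snark_claws_def claw_def)

lemma contract_class_U:
  assumes "i \<in> {1..k}" "j \<in> {1..3}"
  shows "contract_class (snark_claws k) (U j i) = verts (claw i)"
  using assms by (intro contract_class_snark_claws) (auto simp: claw_def nat_1_3_iff)

text \<open>The ends do not depend on \<open>j\<close>: contraction forgets rows, so the twist
  disappears and each column contributes three parallel edges. For \<open>i = k\<close> the ends are
  listed as 1 and \<open>k\<close>, the left one first.\<close>

lemma mends_rim_edge:
  assumes "i \<in> {1..k}" "j \<in> {1..3}"
  shows "mends (contract (flower_snark k) (snark_claws k)) (rim_edge k i j)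
    = {verts (claw (if i < k then i else 1)), verts (claw (if i < k then Suc i else k))}"
proof (cases "i < k")
  case True
  then show ?thesis
    using assms contract_class_U[of i k j] contract_class_U[of "Suc i" k j]
    by (simp add: contract_def rim_edge_def)
next
  case False
  have "(if j = 1 then 1 else 5 - j) \<in> {1..3}"
    using assms(2) by auto
  then have "contract_class (snark_claws k) (U (if j = 1 then 1 else 5 - j) 1) = verts (claw 1)"
    using assms(1) by (intro contract_class_U) auto
  moreover have "contract_class (snark_claws k) (U j k) = verts (claw k)"
    using assms by (intro contract_class_U) auto
  ultimately show ?thesis
    using False by (simp only: contract_def rim_edge_def if_False image_insert image_empty
        multigraph.simps insert_commute)
qed

lemma mverts_contract_snark_claws:
  "mverts (contract (flower_snark k) (snark_claws k)) = (\<lambda>i. verts (claw i)) ` {1..k}"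
proof
  show "mverts (contract (flower_snark k) (snark_claws k)) \<subseteq> (\<lambda>i. verts (claw i)) ` {1..k}"
  proof
    fix C assume "C \<in> mverts (contract (flower_snark k) (snark_claws k))"
    then obtain v where "v \<in> verts (flower_snark k)" "C = contract_class (snark_claws k) v"
      by (auto simp: contract_def)
    moreover from this obtain i where "i \<in> {1..k}" "v \<in> verts (claw i)"
      by (auto simp only: Union_verts_claw[symmetric])
    ultimately show "C \<in> (\<lambda>i. verts (claw i)) ` {1..k}"
      using contract_class_snark_claws by blast
  qed
  show "(\<lambda>i. verts (claw i)) ` {1..k} \<subseteq> mverts (contract (flower_snark k) (snark_claws k))"
  proof
    fix C assume "C \<in> (\<lambda>i. verts (claw i)) ` {1..k}"
    then obtain i where i: "i \<in> {1..k}" "C = verts (claw i)"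
      by auto
    then have "C = contract_class (snark_claws k) (V i)"
      using contract_class_snark_claws[of i k "V i"] by (simp add: claw_def)
    moreover have "V i \<in> verts (flower_snark k)"
      using i by (auto simp: flower_snark_def)
    ultimately show "C \<in> mverts (contract (flower_snark k) (snark_claws k))"
      by (simp add: contract_def)
  qed
qed

lemma medges_contract_snark_claws:
  assumes "e \<in> medges (contract (flower_snark k) (snark_claws k))" "0 < k"
  obtains i j where "i \<in> {1..k}" "j \<in> {1..3}" "e = rim_edge k i j"
proof -
  have e: "e \<in> edges (flower_snark k)" "\<forall>i\<in>{1..k}. e \<notin> edges (claw i)"
    using assms(1) by (auto simp: contract_def snark_claws_def)
  show thesis
    using e(1) \<open>0 < k\<close>
  proof (cases rule: edges_flower_snark_cases)
    case (rim i j)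
    then show thesis
      by (rule that)
  next
    case (claw i j)
    then show thesis
      using e(2) by (auto simp: claw_def nat_1_3_iff)
  qed
qed

lemma planarizing_snark_claws:
  assumes "k \<ge> 3"
  shows "planarizing (flower_snark k) (snark_claws k)"
proof -
  let ?G = "contract (flower_snark k) (snark_claws k)"
  \<comment> \<open>A vertex of the contraction is the vertex set of a claw; its column is read off
    from the one centre in it.\<close>
  define r where "r = (\<lambda>C. real (THE i. V i \<in> C))"
  have r_claw: "r (verts (claw i)) = real i" for i
    by (simp add: r_def claw_def)
  have "\<exists>i j. i \<in> {1..k} \<and> j \<in> {1..3} \<and> e = rim_edge k i j" if "e \<in> medges ?G" for e
    using medges_contract_snark_claws[OF that] assms by (metis not_numeral_le_zero gr0I)
  then obtain I J where IJ: "\<And>e. e \<in> medges ?G \<Longrightarrow>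
      I e \<in> {1..k} \<and> J e \<in> {1..3} \<and> e = rim_edge k (I e) (J e)"
    by metis
  define a where "a = (\<lambda>e. if I e < k then I e else 1)"
  define b where "b = (\<lambda>e. if I e < k then Suc (I e) else k)"
  \<comment> \<open>Edges between consecutive columns get coefficients 1, 2, 3 and those joining 1
    and \<open>k\<close> get 4, 5, 6: parallel edges differ, and the longest arches lie on
    top.\<close>
  define c where "c = (\<lambda>e. real (if I e < k then J e else 3 + J e))"
  have "planar ?G"
  proof (rule planar_if_nested_arches[where r = r and c = c
        and x = "\<lambda>e. verts (claw (a e))" and y = "\<lambda>e. verts (claw (b e))"])
    show "inj_on r (mverts ?G)"
      by (auto simp: mverts_contract_snark_claws inj_on_def r_claw)
  next
    fix e assume "e \<in> medges ?G"
    note e = IJ[OF this]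
    have "mends ?G e = {verts (claw (a e)), verts (claw (b e))}"
      using mends_rim_edge[of "I e" k "J e"] e unfolding a_def b_def by metis
    moreover have "a e \<in> {1..k}" "b e \<in> {1..k}"
      using e assms by (auto simp: a_def b_def)
    ultimately show "verts (claw (a e)) \<in> mverts ?G \<and> verts (claw (b e)) \<in> mverts ?G \<and>
        mends ?G e = {verts (claw (a e)), verts (claw (b e))}"
      by (auto simp: mverts_contract_snark_claws)
    show "r (verts (claw (a e))) < r (verts (claw (b e)))"
      using assms by (auto simp: r_claw a_def b_def)
    show "0 < c e"
      using e by (auto simp: c_def)
  next
    fix e f assume "e \<in> medges ?G" "f \<in> medges ?G" and "e \<noteq> f"
    note e = IJ[OF this(1)] and f = IJ[OF this(2)]
    have "I e \<noteq> I f \<or> J e \<noteq> J f"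
      using e f \<open>e \<noteq> f\<close> by metis
    \<comment> \<open>Two different columns below \<open>k\<close> give intervals side by side. If
      just one column is \<open>k\<close>, its interval contains the other and its coefficient is
      larger. In equal columns the intervals coincide and the rows decide.\<close>
    then have "b e \<le> a f \<or> b f \<le> a e \<or> a f \<le> a e \<and> b e \<le> b f \<and> c e < c f \<or>
        a e \<le> a f \<and> b f \<le> b e \<and> c f < c e"
      using e f unfolding a_def b_def c_def by auto
    then show "r (verts (claw (b e))) \<le> r (verts (claw (a f))) \<or>
       r (verts (claw (b f))) \<le> r (verts (claw (a e))) \<or>
       r (verts (claw (a f))) \<le> r (verts (claw (a e))) \<and>
         r (verts (claw (b e))) \<le> r (verts (claw (b f))) \<and> c e < c f \<or>
       r (verts (claw (a e))) \<le> r (verts (claw (a f))) \<and>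
         r (verts (claw (b f))) \<le> r (verts (claw (b e))) \<and> c f < c e"
      by (simp add: r_claw)
  qed
  then show ?thesis
    by (simp add: planarizing_def)
qed

theorem mainTheorem3:
  fixes k :: nat
  assumes "odd k" and "k \<ge> 3"
  shows "perfect_pseudo_matching (flower_snark k) (snark_claws k)
         \<and> planarizing (flower_snark k) (snark_claws k)"
  using assms(2) perfect_pseudo_matching_snark_claws planarizing_snark_claws by blast

end
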